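(* Let $\mathcal{R}$ be an associative ring with unit $1\neq 0$, let $a\in\mathcal{R}$, let $\mathcal{S}$ be a right ideal of $\mathcal{R}$ and let $\mathcal{S}'$ be a left ideal of $\mathcal{R}$. Then the following statements are equivalent: (1) $a^{(1,2)}_{{\rm rprin}=\mathcal{S},{\rm lprin}=\mathcal{S}'}$ exists, i.e. there is $x\in\mathcal{R}$ with $axa=a$, $xax=x$, $x\mathcal{R}=\mathcal{S}$ and $\mathcal{R}x=\mathcal{S}'$. (2) $\mathcal{R}=a\mathcal{R}\oplus{\rm rann}(\mathcal{S}')$, $\mathcal{R}=\mathcal{S}\oplus{\rm rann}(a)$, $\mathcal{R}=\mathcal{R}a\oplus{\rm lann}(\mathcal{S})$, and $\mathcal{R}=\mathcal{S}'\oplus{\rm lann}(a)$. (3) $\mathcal{R}=a\mathcal{S}\oplus{\rm rann}(\mathcal{S}')$, $a\mathcal{R}\cap{\rm rann}(\mathcal{S}')=\{0\}$, $\mathcal{R}=\mathcal{S}'a\oplus{\rm lann}(\mathcal{S})$, and $\mathcal{R}a\cap{\rm lann}(\mathcal{S})=\{0\}$. (4) There exists $x\in\mathcal{S}\cap\mathcal{S}'$ such that $\varphi_{ax}=\rho_{a\mathcal{S},\,{\rm rann}(\mathcal{S}')}$, $a\mathcal{R}\cap{\rm rann}(\mathcal{S}')=\{0\}$, ${}_{xa}\varphi=\rho_{\mathcal{S}'a,\,{\rm lann}(\mathcal{S})}$, and $\mathcal{R}a\cap{\rm lann}(\mathcal{S})=\{0\}$.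
   Context: Notation: $a\mathcal{R}=\{ar:r\in\mathcal{R}\}$, $\mathcal{R}a=\{ra:r\in\mathcal{R}\}$, $a\mathcal{S}=\{as:s\in\mathcal{S}\}$, $\mathcal{S}'a=\{sa:s\in\mathcal{S}'\}$; ${\rm rann}(a)=\{r:ar=0\}$, ${\rm lann}(a)=\{r:ra=0\}$, and for $\mathcal{A}\subseteq\mathcal{R}$, ${\rm rann}(\mathcal{A})=\{r\in\mathcal{R}:ar=0\ \forall a\in\mathcal{A}\}$, ${\rm lann}(\mathcal{A})=\{r\in\mathcal{R}:ra=0\ \forall a\in\mathcal{A}\}$. The additive group endomorphisms $\varphi_a,{}_a\varphi$ of $\mathcal{R}$ are $\varphi_a(r)=ar$, ${}_a\varphi(r)=ra$. For additive subgroups $\mathcal{S},\mathcal{T}$ of $\mathcal{R}$, $\mathcal{R}=\mathcal{S}\oplus\mathcal{T}$ means $\mathcal{R}=\mathcal{S}+\mathcal{T}$ and $\mathcal{S}\cap\mathcal{T}=\{0\}$; in that case $\rho_{\mathcal{S},\mathcal{T}}:\mathcal{R}\to\mathcal{R}$ is the group endomorphism $\rho_{\mathcal{S},\mathcal{T}}(s+t)=s$ for $s\in\mathcal{S}$, $t\in\mathcal{T}$. Convention: whenever $\rho_{\mathcal{S},\mathcal{T}}$ is written, it is implicitly asserted that $\mathcal{R}=\mathcal{S}\oplus\mathcal{T}$. *)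

theory Defs
  imports Main "HOL-Library.Set_Algebras"
begin

(* An associative ring with unit 1 distinct from 0 is a type of class ring_1 (not necessarily
   commutative; that class includes the axiom that 0 and 1 are distinct), and the whole ring
   is UNIV. *)

definition right_ideal :: "'a::ring_1 set \<Rightarrow> bool" where
  "right_ideal I \<longleftrightarrow>
     0 \<in> I \<and> (\<forall>x\<in>I. \<forall>y\<in>I. x - y \<in> I) \<and> (\<forall>x\<in>I. \<forall>r. x * r \<in> I)"

definition left_ideal :: "'a::ring_1 set \<Rightarrow> bool" where
  "left_ideal I \<longleftrightarrow>
     0 \<in> I \<and> (\<forall>x\<in>I. \<forall>y\<in>I. x - y \<in> I) \<and> (\<forall>x\<in>I. \<forall>r. r * x \<in> I)"

definition lmult :: "'a::ring_1 \<Rightarrow> 'a \<Rightarrow> 'a" where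
  "lmult a = (\<lambda>r. a * r)"

definition rmult :: "'a::ring_1 \<Rightarrow> 'a \<Rightarrow> 'a" where
  "rmult a = (\<lambda>r. r * a)"

(* Consequently aS is lmult a ` S and Sa is rmult a ` S. *)

definition rann :: "'a::ring_1 set \<Rightarrow> 'a set" where
  "rann A = {r. \<forall>a\<in>A. a * r = 0}"

definition lann :: "'a::ring_1 set \<Rightarrow> 'a set" where
  "lann A = {r. \<forall>a\<in>A. r * a = 0}"

(* The ring is the internal direct sum of S and T. Only meant for additive subgroups S and T;
   the sum on the left is the elementwise sum of sets from Set_Algebras. *)
definition ring_direct_sum :: "'a::ring_1 set \<Rightarrow> 'a set \<Rightarrow> bool" where
  "ring_direct_sum S T \<longleftrightarrow> S + T = UNIV \<and> S \<inter> T = {0}"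

(* The projection onto S along T. It is meaningful only if ring_direct_sum S T holds, when the
   described s is unique; otherwise its values are unspecified. *)
definition proj_along :: "'a::ring_1 set \<Rightarrow> 'a set \<Rightarrow> 'a \<Rightarrow> 'a" where
  "proj_along S T = (\<lambda>r. THE s. s \<in> S \<and> (\<exists>t\<in>T. r = s + t))"

(* The equation f = rho_{S,T}, with the tacit claim that the ring is the direct sum of S and T. *)
definition is_proj_along :: "('a::ring_1 \<Rightarrow> 'a) \<Rightarrow> 'a set \<Rightarrow> 'a set \<Rightarrow> bool" where
  "is_proj_along f S T \<longleftrightarrow> ring_direct_sum S T \<and> f = proj_along S T"

(* x is a {1,2}-inverse of a with right principal ideal S and left principal ideal S'. *)
definition is_12_inverse_rprin_lprin ::
    "'a::ring_1 \<Rightarrow> 'a set \<Rightarrow> 'a set \<Rightarrow> 'a \<Rightarrow> bool" where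
  "is_12_inverse_rprin_lprin a S S' x \<longleftrightarrow>
     a * x * a = a \<and> x * a * x = x \<and> lmult x ` UNIV = S \<and> rmult x ` UNIV = S'"

end

theory Submission
  imports Defs
begin

text \<open>
  The inverse is the common component of two decompositions of the unit. If
  \<open>1 = a s + t\<close> with \<open>s \<in> S\<close>, \<open>t \<in> rann S'\<close> and \<open>1 = s' a + t'\<close> with \<open>s' \<in> S'\<close>,
  \<open>t' \<in> lann S\<close>, then multiplying the first equation by \<open>s'\<close> from the left and the second by
  \<open>s\<close> from the right gives \<open>s' = s' a s = s\<close>. So the two decompositions, one on each side,
  produce a single element \<open>x \<in> S \<inter> S'\<close> such that \<open>1 - a x\<close> is annihilated by \<open>S'\<close> and
  \<open>1 - x a\<close> annihilates \<open>S\<close> (lemma \<open>common_component_of_one\<close>).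
  Such an \<open>x\<close> satisfies \<open>x a x = x\<close>, \<open>x R = S\<close> and \<open>R x = S'\<close> because \<open>a x\<close> and \<open>x a\<close> act as
  units on \<open>S'\<close> and \<open>S\<close>. The condition \<open>a R \<inter> rann S' = {0}\<close> adds \<open>a x a = a\<close>, since
  \<open>a - a x a\<close> lies in that intersection (lemma \<open>is_12_inverse_if_complements_annihilate\<close>).

  The projections come in because a projection along right ideals that is a left multiplication
  is determined by its value at \<open>1\<close>: saying that multiplication by \<open>e\<close> is the
  projection onto \<open>I\<close> along \<open>J\<close> means just \<open>e \<in> I\<close> and \<open>1 - e \<in> J\<close>, once \<open>I \<inter> J = {0}\<close>.
  Conversely, for a pair of mutually inverse elements \<open>a\<close>, \<open>x\<close> the idempotents \<open>a x\<close> and \<open>x a\<close>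
  yield the Peirce decompositions of the second statement, and \<open>R = S + rann a\<close> implies
  \<open>a S = a R\<close>, which turns the second statement into the third.
\<close>

section \<open>Ideals and annihilators\<close>

lemma right_ideal_rann:
  fixes L :: "'a::ring_1 set"
  shows "right_ideal (rann L)"
  by (auto simp: right_ideal_def rann_def right_diff_distrib mult.assoc[symmetric])

lemma left_ideal_lann:
  fixes I :: "'a::ring_1 set"
  shows "left_ideal (lann I)"
  by (auto simp: left_ideal_def lann_def left_diff_distrib mult.assoc)

lemma right_ideal_lmult_image:
  assumes "right_ideal I"
  shows "right_ideal (lmult a ` I)"
proof -
  have "0 \<in> lmult a ` I"
    using assms by (intro image_eqI[of _ _ 0]) (auto simp: right_ideal_def lmult_def)
  moreover have "a * u - a * v \<in> lmult a ` I" if "u \<in> I" "v \<in> I" for u v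
    using assms that
    by (intro image_eqI[of _ _ "u - v"]) (auto simp: right_ideal_def lmult_def right_diff_distrib)
  moreover have "a * u * r \<in> lmult a ` I" if "u \<in> I" for u r
    using assms that
    by (intro image_eqI[of _ _ "u * r"]) (auto simp: right_ideal_def lmult_def mult.assoc)
  ultimately show ?thesis by (auto simp: right_ideal_def lmult_def)
qed

lemma left_ideal_rmult_image:
  assumes "left_ideal L"
  shows "left_ideal (rmult a ` L)"
proof -
  have "0 \<in> rmult a ` L"
    using assms by (intro image_eqI[of _ _ 0]) (auto simp: left_ideal_def rmult_def)
  moreover have "u * a - v * a \<in> rmult a ` L" if "u \<in> L" "v \<in> L" for u v
    using assms that
    by (intro image_eqI[of _ _ "u - v"]) (auto simp: left_ideal_def rmult_def left_diff_distrib)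
  moreover have "r * (u * a) \<in> rmult a ` L" if "u \<in> L" for u r
    using assms that
    by (intro image_eqI[of _ _ "r * u"]) (auto simp: left_ideal_def rmult_def mult.assoc)
  ultimately show ?thesis by (auto simp: left_ideal_def rmult_def)
qed

lemma rann_left_principal: "rann (rmult x ` UNIV) = rann {x}"
  unfolding rann_def rmult_def by (auto simp: mult.assoc) (metis mult_1_left)

lemma lann_right_principal: "lann (lmult x ` UNIV) = lann {x}"
  unfolding lann_def lmult_def by (auto simp: mult.assoc[symmetric]) (metis mult_1_right)

section \<open>Direct sums and projections\<close>

lemma decomposition_if_plus_eq_UNIV:
  assumes "I + J = UNIV"
  obtains s t where "s \<in> I" "t \<in> J" "r = s + t"
proof -
  have "r \<in> I + J" using assms by simp
  then show thesis using that by (elim set_plus_elim) blast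
qed

lemma ring_direct_sumI:
  assumes "\<And>r. f r \<in> I" "\<And>r. r - f r \<in> J" "I \<inter> J = {0}"
  shows "ring_direct_sum I J"
proof -
  have "r \<in> I + J" for r
    using set_plus_intro[OF assms(1)[of r] assms(2)[of r]] by simp
  then show ?thesis
    using assms(3) by (auto simp: ring_direct_sum_def)
qed

lemma proj_along_eqI:
  assumes closed: "\<And>u v. u \<in> I \<Longrightarrow> v \<in> I \<Longrightarrow> u - v \<in> I" "\<And>u v. u \<in> J \<Longrightarrow> v \<in> J \<Longrightarrow> u - v \<in> J"
    and disj: "I \<inter> J = {0}" and s: "s \<in> I" "r - s \<in> J"
  shows "proj_along I J r = s"
  unfolding proj_along_def
proof (rule the_equality)
  show "s \<in> I \<and> (\<exists>t\<in>J. r = s + t)"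
    using s by (intro conjI bexI[of _ "r - s"]) simp_all
next
  fix u assume "u \<in> I \<and> (\<exists>t\<in>J. r = u + t)"
  then have u: "u \<in> I" "r - u \<in> J" by auto
  have "u - s = (r - s) - (r - u)" by simp
  then have "u - s \<in> I \<inter> J"
    using closed(1)[OF u(1) s(1)] closed(2)[OF s(2) u(2)] by simp
  then show "u = s" using disj by simp
qed

text \<open>
  Being a projection is a pointwise condition, which frees later arguments from the definite
  description in \<^const>\<open>proj_along\<close>.
\<close>

lemma is_proj_along_iff:
  assumes closed: "\<And>u v. u \<in> I \<Longrightarrow> v \<in> I \<Longrightarrow> u - v \<in> I" "\<And>u v. u \<in> J \<Longrightarrow> v \<in> J \<Longrightarrow> u - v \<in> J"
  shows "is_proj_along f I J \<longleftrightarrow> I \<inter> J = {0} \<and> (\<forall>r. f r \<in> I \<and> r - f r \<in> J)"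
proof
  assume proj: "is_proj_along f I J"
  then have sum: "I + J = UNIV" and disj: "I \<inter> J = {0}" and f: "f = proj_along I J"
    by (auto simp: is_proj_along_def ring_direct_sum_def)
  have "f r \<in> I \<and> r - f r \<in> J" for r
  proof -
    obtain s t where st: "s \<in> I" "t \<in> J" "r = s + t"
      using sum by (rule decomposition_if_plus_eq_UNIV)
    then have "f r = s"
      unfolding f by (intro proj_along_eqI[OF closed disj]) auto
    with st show ?thesis by simp
  qed
  with disj show "I \<inter> J = {0} \<and> (\<forall>r. f r \<in> I \<and> r - f r \<in> J)" by blast
next
  assume *: "I \<inter> J = {0} \<and> (\<forall>r. f r \<in> I \<and> r - f r \<in> J)"
  then have "f r = proj_along I J r" for r
    using proj_along_eqI[OF closed, of "f r" r] by simp
  with * show "is_proj_along f I J"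
    using ring_direct_sumI[of f I J] by (auto simp: is_proj_along_def)
qed

text \<open>
  A left multiplication is a homomorphism of right modules, so when both summands are right
  ideals its values \<open>e r\<close> and the remainders \<open>(1 - e) r\<close> are controlled by the case \<open>r = 1\<close>.
\<close>

lemma is_proj_along_lmult_iff:
  assumes I: "right_ideal I" and J: "right_ideal J"
  shows "is_proj_along (lmult e) I J \<longleftrightarrow> I \<inter> J = {0} \<and> e \<in> I \<and> 1 - e \<in> J"
proof -
  have "(\<forall>r. lmult e r \<in> I \<and> r - lmult e r \<in> J) \<longleftrightarrow> e \<in> I \<and> 1 - e \<in> J"
  proof
    assume *: "\<forall>r. lmult e r \<in> I \<and> r - lmult e r \<in> J"
    show "e \<in> I \<and> 1 - e \<in> J" using *[rule_format, of 1] by (simp add: lmult_def)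
  next
    assume e: "e \<in> I \<and> 1 - e \<in> J"
    have "e * r \<in> I" "(1 - e) * r \<in> J" for r
      using I J e by (auto simp: right_ideal_def)
    then show "\<forall>r. lmult e r \<in> I \<and> r - lmult e r \<in> J"
      by (simp add: lmult_def left_diff_distrib)
  qed
  moreover have "is_proj_along (lmult e) I J \<longleftrightarrow>
      I \<inter> J = {0} \<and> (\<forall>r. lmult e r \<in> I \<and> r - lmult e r \<in> J)"
    using I J by (intro is_proj_along_iff) (auto simp: right_ideal_def)
  ultimately show ?thesis by simp
qed

lemma is_proj_along_rmult_iff:
  assumes I: "left_ideal I" and J: "left_ideal J"
  shows "is_proj_along (rmult e) I J \<longleftrightarrow> I \<inter> J = {0} \<and> e \<in> I \<and> 1 - e \<in> J"
proof -
  have "(\<forall>r. rmult e r \<in> I \<and> r - rmult e r \<in> J) \<longleftrightarrow> e \<in> I \<and> 1 - e \<in> J"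
  proof
    assume *: "\<forall>r. rmult e r \<in> I \<and> r - rmult e r \<in> J"
    show "e \<in> I \<and> 1 - e \<in> J" using *[rule_format, of 1] by (simp add: rmult_def)
  next
    assume e: "e \<in> I \<and> 1 - e \<in> J"
    have "r * e \<in> I" "r * (1 - e) \<in> J" for r
      using I J e by (auto simp: left_ideal_def)
    then show "\<forall>r. rmult e r \<in> I \<and> r - rmult e r \<in> J"
      by (simp add: rmult_def right_diff_distrib)
  qed
  moreover have "is_proj_along (rmult e) I J \<longleftrightarrow>
      I \<inter> J = {0} \<and> (\<forall>r. rmult e r \<in> I \<and> r - rmult e r \<in> J)"
    using I J by (intro is_proj_along_iff) (auto simp: left_ideal_def)
  ultimately show ?thesis by simp
qed

section \<open>Decompositions induced by mutually inverse elements\<close>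

text \<open>
  These are the Peirce decompositions for the idempotents \<open>b c\<close> and \<open>c b\<close>: the mutual inverse
  relations give \<open>b R = b c R\<close>, \<open>rann c = rann (b c)\<close> and \<open>R b = R c b\<close>, \<open>lann c = lann (c b)\<close>.
  The hypotheses are symmetric in \<open>b\<close> and \<open>c\<close>, so each lemma serves both \<open>a\<close> and its inverse.
\<close>

lemma ring_direct_sum_rann_if_inverse:
  assumes "b * c * b = b" "c * b * c = c"
  shows "ring_direct_sum (lmult b ` UNIV) (rann {c})"
proof (rule ring_direct_sumI[where f = "lmult (b * c)"])
  show "lmult (b * c) r \<in> lmult b ` UNIV" for r
    by (simp add: lmult_def mult.assoc)
  show "r - lmult (b * c) r \<in> rann {c}" for r
    using assms(2) by (simp add: lmult_def rann_def right_diff_distrib mult.assoc[symmetric])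
  have "b * r = 0" if "c * (b * r) = 0" for r
  proof -
    have "b * r = b * (c * (b * r))"
      using assms(1) by (simp add: mult.assoc[symmetric])
    with that show ?thesis by simp
  qed
  then show "lmult b ` UNIV \<inter> rann {c} = {0}"
    by (auto simp: lmult_def rann_def image_iff intro!: exI[of _ 0])
qed

lemma ring_direct_sum_lann_if_inverse:
  assumes "b * c * b = b" "c * b * c = c"
  shows "ring_direct_sum (rmult b ` UNIV) (lann {c})"
proof (rule ring_direct_sumI[where f = "rmult (c * b)"])
  show "rmult (c * b) r \<in> rmult b ` UNIV" for r
    by (simp add: rmult_def mult.assoc[symmetric])
  show "r - rmult (c * b) r \<in> lann {c}" for r
    using assms(2) by (simp add: rmult_def lann_def left_diff_distrib mult.assoc)
  have "r * b = 0" if "r * b * c = 0" for r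
  proof -
    have "r * b = r * b * c * b"
      using assms(1) by (simp add: mult.assoc)
    with that show ?thesis by simp
  qed
  then show "rmult b ` UNIV \<inter> lann {c} = {0}"
    by (auto simp: rmult_def lann_def image_iff intro!: exI[of _ 0])
qed

lemma lmult_image_eq_if_plus_rann:
  assumes "I + rann {a} = UNIV"
  shows "lmult a ` I = lmult a ` UNIV"
proof -
  have "a * r \<in> lmult a ` I" for r
  proof -
    obtain s t where "s \<in> I" "t \<in> rann {a}" "r = s + t"
      using assms by (rule decomposition_if_plus_eq_UNIV)
    then show ?thesis by (auto simp: lmult_def rann_def distrib_left)
  qed
  then show ?thesis by (auto simp: lmult_def)
qed

lemma rmult_image_eq_if_plus_lann:
  assumes "L + lann {a} = UNIV"
  shows "rmult a ` L = rmult a ` UNIV"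
proof -
  have "r * a \<in> rmult a ` L" for r
  proof -
    obtain s t where "s \<in> L" "t \<in> lann {a}" "r = s + t"
      using assms by (rule decomposition_if_plus_eq_UNIV)
    then show ?thesis by (auto simp: rmult_def lann_def distrib_right)
  qed
  then show ?thesis by (auto simp: rmult_def)
qed

section \<open>Recovering the inverse from the decompositions\<close>

text \<open>
  Here the components \<open>s \<in> S\<close> and \<open>s' \<in> S'\<close> of the two decompositions of \<open>1\<close> are forced
  to agree: \<open>s' a s\<close> equals \<open>s'\<close> because \<open>1 - a s\<close> is annihilated by \<open>S'\<close>, and equals \<open>s\<close>
  because \<open>1 - s' a\<close> annihilates \<open>S\<close>.
\<close>

lemma common_component_of_one:
  assumes "lmult a ` S + rann S' = UNIV" and "rmult a ` S' + lann S = UNIV"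
  obtains x where "x \<in> S" "x \<in> S'" "1 - a * x \<in> rann S'" "1 - x * a \<in> lann S"
proof -
  obtain s t where s: "s \<in> S" "t \<in> rann S'" "1 = a * s + t"
    by (rule decomposition_if_plus_eq_UNIV[OF assms(1), of 1]) (auto simp: lmult_def)
  obtain s' t' where s': "s' \<in> S'" "t' \<in> lann S" "1 = s' * a + t'"
    by (rule decomposition_if_plus_eq_UNIV[OF assms(2), of 1]) (auto simp: rmult_def)
  have "s' = s' * (a * s + t)" using s(3) by simp
  also have "\<dots> = s' * a * s"
    using s(2) s'(1) by (simp add: rann_def distrib_left mult.assoc)
  also have "\<dots> = (s' * a + t') * s"
    using s(1) s'(2) by (simp add: lann_def distrib_right)
  also have "\<dots> = s" using s'(3) by simp
  finally have eq: "s' = s" .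
  have "1 - a * s = t" "1 - s * a = t'"
    using s(3) s'(3) eq by (simp_all add: algebra_simps)
  with s s' eq that show thesis by simp
qed

text \<open>
  The annihilation conditions say that \<open>a x\<close> is a right unit on \<open>S'\<close> and \<open>x a\<close> a left unit on
  \<open>S\<close>, which makes \<open>S\<close> and \<open>S'\<close> principal with generator \<open>x\<close>.
\<close>

lemma is_12_inverse_if_complements_annihilate:
  assumes S: "right_ideal S" and S': "left_ideal S'"
    and x: "x \<in> S" "x \<in> S'"
    and ax: "1 - a * x \<in> rann S'" and xa: "1 - x * a \<in> lann S"
    and disj: "lmult a ` UNIV \<inter> rann S' = {0}"
  shows "is_12_inverse_rprin_lprin a S S' x"
proof -
  have unit': "s * (a * x) = s" if "s \<in> S'" for s
    using ax that by (simp add: rann_def right_diff_distrib)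
  have unit: "x * a * s = s" if "s \<in> S" for s
    using xa that by (simp add: lann_def left_diff_distrib)
  have "a - a * x * a = a * (1 - x * a)"
    by (simp add: right_diff_distrib mult.assoc)
  then have "a - a * x * a \<in> lmult a ` UNIV" by (simp add: lmult_def)
  moreover have "a - a * x * a = (1 - a * x) * a" by (simp add: left_diff_distrib)
  then have "a - a * x * a \<in> rann S'"
    using ax right_ideal_rann[of S'] by (simp add: right_ideal_def)
  ultimately have "a - a * x * a \<in> {0}" unfolding disj[symmetric] by (rule IntI)
  then have "a * x * a = a" by simp
  moreover have "lmult x ` UNIV = S"
  proof
    show "lmult x ` UNIV \<subseteq> S" using S x(1) by (auto simp: right_ideal_def lmult_def)
    show "S \<subseteq> lmult x ` UNIV"
    proof
      fix s assume "s \<in> S"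
      then show "s \<in> lmult x ` UNIV"
        using unit[of s] by (intro image_eqI[of _ _ "a * s"]) (simp_all add: lmult_def mult.assoc)
    qed
  qed
  moreover have "rmult x ` UNIV = S'"
  proof
    show "rmult x ` UNIV \<subseteq> S'" using S' x(2) by (auto simp: left_ideal_def rmult_def)
    show "S' \<subseteq> rmult x ` UNIV"
    proof
      fix s assume "s \<in> S'"
      then show "s \<in> rmult x ` UNIV"
        using unit'[of s] by (intro image_eqI[of _ _ "s * a"]) (simp_all add: rmult_def mult.assoc)
    qed
  qed
  ultimately show ?thesis
    using unit[OF x(1)] by (simp add: is_12_inverse_rprin_lprin_def)
qed

section \<open>The equivalence\<close>

theorem theorem6p13:
  fixes a :: "'a::ring_1" and S S' :: "'a set"
  assumes "right_ideal S" and "left_ideal S'"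
  defines "stmt1 \<equiv> \<exists>x. is_12_inverse_rprin_lprin a S S' x"
    and "stmt2 \<equiv>
      ring_direct_sum (lmult a ` UNIV) (rann S') \<and>
      ring_direct_sum S (rann {a}) \<and>
      ring_direct_sum (rmult a ` UNIV) (lann S) \<and>
      ring_direct_sum S' (lann {a})"
    and "stmt3 \<equiv>
      ring_direct_sum (lmult a ` S) (rann S') \<and>
      lmult a ` UNIV \<inter> rann S' = {0} \<and>
      ring_direct_sum (rmult a ` S') (lann S) \<and>
      rmult a ` UNIV \<inter> lann S = {0}"
    and "stmt4 \<equiv>
      \<exists>x \<in> S \<inter> S'.
        is_proj_along (lmult (a * x)) (lmult a ` S) (rann S') \<and>
        lmult a ` UNIV \<inter> rann S' = {0} \<and>
        is_proj_along (rmult (x * a)) (rmult a ` S') (lann S) \<and>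
        rmult a ` UNIV \<inter> lann S = {0}"
  shows "(stmt1 \<longleftrightarrow> stmt2) \<and> (stmt2 \<longleftrightarrow> stmt3) \<and> (stmt3 \<longleftrightarrow> stmt4)"
proof -
  have proj_l: "is_proj_along (lmult (a * x)) (lmult a ` S) (rann S') \<longleftrightarrow>
      lmult a ` S \<inter> rann S' = {0} \<and> a * x \<in> lmult a ` S \<and> 1 - a * x \<in> rann S'" for x
    by (intro is_proj_along_lmult_iff right_ideal_lmult_image right_ideal_rann assms(1))
  have proj_r: "is_proj_along (rmult (x * a)) (rmult a ` S') (lann S) \<longleftrightarrow>
      rmult a ` S' \<inter> lann S = {0} \<and> x * a \<in> rmult a ` S' \<and> 1 - x * a \<in> lann S" for x
    by (intro is_proj_along_rmult_iff left_ideal_rmult_image left_ideal_lann assms(2))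
  have "stmt1 \<Longrightarrow> stmt2"
  proof -
    assume stmt1
    then obtain x where inv: "a * x * a = a" "x * a * x = x"
      and S: "S = lmult x ` UNIV" and S': "S' = rmult x ` UNIV"
      by (auto simp: stmt1_def is_12_inverse_rprin_lprin_def)
    show stmt2
      unfolding stmt2_def S S' rann_left_principal lann_right_principal
      by (intro conjI ring_direct_sum_rann_if_inverse ring_direct_sum_lann_if_inverse inv)
  qed
  moreover have "stmt2 \<Longrightarrow> stmt3"
  proof -
    assume stmt2
    moreover from this have "lmult a ` S = lmult a ` UNIV" "rmult a ` S' = rmult a ` UNIV"
      by (auto simp: stmt2_def ring_direct_sum_def
          intro!: lmult_image_eq_if_plus_rann rmult_image_eq_if_plus_lann)
    ultimately show stmt3
      by (simp add: stmt2_def stmt3_def ring_direct_sum_def)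
  qed
  moreover have "stmt3 \<Longrightarrow> stmt4"
  proof -
    assume stmt3: stmt3
    then have "lmult a ` S + rann S' = UNIV" "rmult a ` S' + lann S = UNIV"
      by (simp_all add: stmt3_def ring_direct_sum_def)
    then obtain x where x: "x \<in> S" "x \<in> S'" "1 - a * x \<in> rann S'" "1 - x * a \<in> lann S"
      by (rule common_component_of_one)
    moreover from x have "a * x \<in> lmult a ` S" "x * a \<in> rmult a ` S'"
      by (auto simp: lmult_def rmult_def)
    ultimately show stmt4
      using stmt3 unfolding stmt4_def stmt3_def proj_l proj_r ring_direct_sum_def by blast
  qed
  moreover have "stmt4 \<Longrightarrow> stmt1"
    unfolding stmt4_def stmt1_def proj_l proj_r
    using is_12_inverse_if_complements_annihilate[OF assms(1,2)] by blast
  ultimately show ?thesis by blast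
qed

end
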